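(* Let $K$ be a closed convex cone in a finite dimensional Euclidean space $X$. Then $K$ is nice if and only if $x_{F,H} \in M_F K^*$ for all faces $F$ of $K$ and all properly minimal faces $H$ of $F^*$.
   Context: All spaces are finite dimensional Euclidean spaces with inner product $\langle\cdot,\cdot\rangle$. A cone is a nonempty set $C$ with $\lambda x\in C$ for all $x\in C$, $\lambda\ge 0$. For a convex cone $C\subseteq X$: the dual cone is $C^*=\{y\in X : \langle y,x\rangle\ge 0 \ \forall x\in C\}$; the lineality space is $\operatorname{lspace} C = C\cap(-C)$. For a set $S$, $\operatorname{lin} S$ is its linear span and $S^\perp$ is the orthogonal complement in $X$ of $\operatorname{lin} S$. For a vector $y$, $\operatorname{cone} y=\{\lambda y:\lambda\ge0\}$. For a face $F$ of $K$, $F^*$ is the dual cone of $F$ taken in the whole space $X$. A nonempty convex subset $E$ of a closed convex cone $C$ is a face of $C$ if $x_1,x_2\in C$ and $x_1+x_2\in E$ imply $x_1,x_2\in E$. The cone $C$ itself is a face, and $\operatorname{lspace} C$ is the inclusionwise smallest face. A face $E$ of $C$ is properly minimal if $E\neq \operatorname{lspace} C$ and there is no face $E'$ of $C$ with $\operatorname{lspace} C\subsetneq E'\subsetneq E$. Properly minimal faces of a pointed cone ($\operatorname{lspace} C=\{0\}$) are called extreme rays. A closed convex cone $K$ is nice if the set $K^*+F^\perp$ is closed for all faces $F$ of $K$ (equivalently, $F^*=K^*+F^\perp$ for all faces $F$ of $K$). For a face $F$ of $K$, $M_F$ denotes the orthogonal projection operator of $X$ onto $\operatorname{lin} F$, and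 $M_FK^*$ is the image of $K^*$ under it. One has $\operatorname{lspace} F^*=F^\perp$, and if $H$ is a properly minimal face of $F^*$, then $H\cap\operatorname{lin}F$ is an extreme ray of the pointed cone $F^*\cap\operatorname{lin}F$; $x_{F,H}$ denotes the unique vector of norm $1$ with $\operatorname{cone} x_{F,H}=H\cap\operatorname{lin}F$.
   Formalization: Faces are required to be convex cones, not merely nonempty convex subsets with the sum property; under the literal definition [0,1] is a face of [0,∞), no properly minimal faces exist, and the claim fails for cones that are not nice. *)

theory Defs
  imports "HOL-Analysis.Analysis"
begin

definition dual_cone :: "'a::euclidean_space set \<Rightarrow> 'a set" where
  "dual_cone C = {y. \<forall>x\<in>C. y \<bullet> x \<ge> 0}"

definition lspace :: "'a::euclidean_space set \<Rightarrow> 'a set" where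
  "lspace C = C \<inter> uminus ` C"

definition ray :: "'a::euclidean_space \<Rightarrow> 'a set" where
  "ray y = {c *\<^sub>R y | c. c \<ge> 0}"

(* E is required to be a cone, not merely a nonempty convex set: the sum condition alone
   would also admit the segment {0..1} as a face of the half-line {0..}. For a convex cone C
   this is the usual notion, see cone_face_iff_face_of. *)
definition cone_face :: "'a::euclidean_space set \<Rightarrow> 'a set \<Rightarrow> bool" where
  "cone_face E C \<longleftrightarrow> E \<subseteq> C \<and> convex_cone E \<and>
     (\<forall>x1\<in>C. \<forall>x2\<in>C. x1 + x2 \<in> E \<longrightarrow> x1 \<in> E \<and> x2 \<in> E)"

definition properly_minimal_face :: "'a::euclidean_space set \<Rightarrow> 'a set \<Rightarrow> bool" where
  "properly_minimal_face E C \<longleftrightarrow> cone_face E C \<and> E \<noteq> lspace C \<and>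
     \<not> (\<exists>E'. cone_face E' C \<and> lspace C \<subset> E' \<and> E' \<subset> E)"

definition nice :: "'a::euclidean_space set \<Rightarrow> bool" where
  "nice K \<longleftrightarrow> (\<forall>F. cone_face F K \<longrightarrow> closed (dual_cone K + (span F)\<^sup>\<bottom>))"

(* Orthogonal projection onto a linear subspace; see orth_proj for well-definedness. *)
definition orth_proj :: "'a::euclidean_space set \<Rightarrow> 'a \<Rightarrow> 'a" where
  "orth_proj S x = (THE p. p \<in> S \<and> x - p \<in> S\<^sup>\<bottom>)"

(* The vector x_{F,H}; meaningful when H is a properly minimal face of the dual cone of F. *)
definition face_unit_vector :: "'a::euclidean_space set \<Rightarrow> 'a set \<Rightarrow> 'a" where
  "face_unit_vector F H = (THE x. norm x = 1 \<and> ray x = H \<inter> span F)"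

lemma cone_face_iff_face_of:
  assumes C: "convex_cone C"
  shows "cone_face E C \<longleftrightarrow> E \<noteq> {} \<and> E face_of C"
proof
  assume "cone_face E C"
  then have E: "E \<subseteq> C" "convex_cone E"
    and s: "\<And>x y. x \<in> C \<Longrightarrow> y \<in> C \<Longrightarrow> x + y \<in> E \<Longrightarrow> x \<in> E \<and> y \<in> E"
    unfolding cone_face_def by blast+
  have "a \<in> E \<and> b \<in> E" if ab: "a \<in> C" "b \<in> C" "x \<in> E" "x \<in> open_segment a b" for a b x
  proof -
    obtain u where u: "0 < u" "u < 1" "x = (1 - u) *\<^sub>R a + u *\<^sub>R b"
      using ab(4) unfolding in_segment by blast
    have "(1 - u) *\<^sub>R a \<in> C" "u *\<^sub>R b \<in> C"
      using convex_cone_scaleR[OF C] ab u by simp_all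
    then have m: "(1 - u) *\<^sub>R a \<in> E" "u *\<^sub>R b \<in> E"
      using s ab(3) unfolding u(3) by blast+
    show ?thesis
      using convex_cone_scaleR[OF E(2) _ m(1), of "1 / (1 - u)"]
        convex_cone_scaleR[OF E(2) _ m(2), of "1 / u"] u(1,2) by simp
  qed
  then show "E \<noteq> {} \<and> E face_of C"
    using E unfolding face_of_def convex_cone_def by blast
next
  assume f: "E \<noteq> {} \<and> E face_of C"
  have con: "conic E"
    using C f face_of_conic unfolding convex_cone_def by blast
  have "x \<in> E \<and> y \<in> E" if xy: "x \<in> C" "y \<in> C" "x + y \<in> E" for x y
  proof -
    have mid: "midpoint x y \<in> E"
      unfolding midpoint_def by (rule conicD[OF con xy(3)]) simp
    show ?thesis
    proof (cases "x = y")
      case True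
      then show ?thesis using mid by simp
    next
      case False
      then have "midpoint x y \<in> open_segment x y" by simp
      from face_ofD[OF conjunct2[OF f] this xy(1,2) mid] show ?thesis .
    qed
  qed
  moreover have "E \<subseteq> C" "convex E"
    using f unfolding face_of_def by blast+
  ultimately show "cone_face E C"
    using f con unfolding cone_face_def convex_cone_def by blast
qed

lemma orth_proj:
  assumes S: "subspace S"
  shows "orth_proj S x \<in> S \<and> x - orth_proj S x \<in> S\<^sup>\<bottom>"
proof -
  have "\<exists>!p. p \<in> S \<and> x - p \<in> S\<^sup>\<bottom>"
  proof (rule ex_ex1I)
    obtain y z where yz: "y \<in> span S" "\<And>w. w \<in> span S \<Longrightarrow> orthogonal z w" "x = y + z"
      using orthogonal_subspace_decomp_exists[of S x] by metis
    then have "y \<in> S \<and> x - y \<in> S\<^sup>\<bottom>"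
      using S unfolding span_eq_iff[THEN iffD2, OF S] orthogonal_comp_def
      by (simp add: orthogonal_commute)
    then show "\<exists>p. p \<in> S \<and> x - p \<in> S\<^sup>\<bottom>" by blast
  next
    fix p q assume pq: "p \<in> S \<and> x - p \<in> S\<^sup>\<bottom>" "q \<in> S \<and> x - q \<in> S\<^sup>\<bottom>"
    have "p - q \<in> S" using S pq by (simp add: subspace_diff)
    moreover have "(x - q) - (x - p) \<in> S\<^sup>\<bottom>"
      by (rule subspace_diff[OF subspace_orthogonal_comp]) (use pq in simp_all)
    ultimately have "orthogonal (p - q) (p - q)" by (simp add: orthogonal_comp_def)
    then show "p = q" by (simp add: orthogonal_self)
  qed
  then show ?thesis unfolding orth_proj_def by (rule theI')
qed

end

theory Submission
  imports Defs
begin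

text \<open>
  Fix a face \<open>F\<close> of \<open>K\<close>, write \<open>S\<close> for its span and \<open>D\<close> for its dual cone. Always
  \<open>dual_cone K + S\<^sup>\<bottom> \<subseteq> D\<close>, and since \<open>F = K \<inter> S\<close>, the bipolar theorem identifies \<open>D\<close> as the closure
  of the left-hand side. So niceness at \<open>F\<close> means \<open>D \<subseteq> dual_cone K + S\<^sup>\<bottom>\<close>
  (\<open>closed_dual_cone_plus_iff\<close>). As \<open>D\<close> is invariant under translation by \<open>S\<^sup>\<bottom>\<close>, it suffices to test
  this inclusion on \<open>D \<inter> S\<close>, and a point of \<open>S\<close> lies in \<open>dual_cone K + S\<^sup>\<bottom>\<close> iff it is
  the projection onto \<open>S\<close> of a point of \<open>dual_cone K\<close>.

  It remains to see that the unit vectors attached to the properly minimal faces of \<open>D\<close> generate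
  \<open>D \<inter> S\<close> as a convex cone. A point \<open>a\<close> in the relative interior of \<open>F\<close> is a linear functional that is
  positive on \<open>D \<inter> S\<close> outside the origin, so the slice of \<open>D \<inter> S\<close> at height 1 is
  compact and, by the Krein-Milman theorem, the convex hull of its extreme points \<open>e\<close>. For each of
  these, \<open>ray e + S\<^sup>\<bottom>\<close> is a properly minimal face of \<open>D\<close> with unit vector \<open>e /\<^sub>R norm e\<close>
  (\<open>properly_minimal_face_ray_plus\<close>). Slicing \<open>H \<inter> S\<close> instead, for a face \<open>H\<close> of
  \<open>D\<close>, shows that every properly minimal face arises in this way
  (\<open>properly_minimal_face_dual_coneE\<close>), which makes the unit vector well defined.
\<close>

section \<open>Dual cones and orthogonal complements of spans\<close>

lemma convex_cone_dual_cone: "convex_cone (dual_cone C)"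
proof -
  have "0 \<in> dual_cone C"
    by (simp add: dual_cone_def)
  then show ?thesis
    by (auto simp: convex_cone_iff dual_cone_def inner_add_left)
qed

lemma closed_dual_cone: "closed (dual_cone C)"
proof -
  have "dual_cone C = (\<Inter>x\<in>C. {y. x \<bullet> y \<ge> 0})"
    by (auto simp: dual_cone_def inner_commute)
  then show ?thesis
    by (simp add: closed_INT closed_halfspace_ge)
qed

lemma in_orthogonal_comp_span_iff: "x \<in> (span F)\<^sup>\<bottom> \<longleftrightarrow> (\<forall>f\<in>F. x \<bullet> f = 0)"
proof
  assume "\<forall>f\<in>F. x \<bullet> f = 0"
  then have "orthogonal x y" if "y \<in> span F" for y
    using orthogonal_to_span[OF that, of x] by (simp add: orthogonal_def)
  then show "x \<in> (span F)\<^sup>\<bottom>"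
    by (simp add: orthogonal_comp_def orthogonal_commute)
qed (auto simp: orthogonal_comp_def orthogonal_def inner_commute span_base)

lemma Int_orthogonal_comp_eq_0: "x \<in> S \<Longrightarrow> x \<in> S\<^sup>\<bottom> \<Longrightarrow> x = 0"
  by (auto simp: orthogonal_comp_def orthogonal_self)

lemma subspace_orthogonal_decomp:
  fixes S :: "'a::euclidean_space set"
  assumes "subspace S"
  obtains p l where "p \<in> S" "l \<in> S\<^sup>\<bottom>" "x = p + l"
  using orth_proj[OF assms, of x] that[of "orth_proj S x" "x - orth_proj S x"] by auto

lemma lspace_dual_cone: "lspace (dual_cone F) = (span F)\<^sup>\<bottom>"
proof -
  have "x \<in> uminus ` dual_cone F \<longleftrightarrow> - x \<in> dual_cone F" for x :: 'a
    by (metis image_iff minus_minus)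
  then show ?thesis
    unfolding lspace_def set_eq_iff Int_iff in_orthogonal_comp_span_iff
    by (auto simp: dual_cone_def intro: antisym)
qed

lemma dual_cone_add_orthogonal_comp:
  assumes "x \<in> dual_cone F" "l \<in> (span F)\<^sup>\<bottom>"
  shows "x + l \<in> dual_cone F"
  using assms by (simp add: in_orthogonal_comp_span_iff dual_cone_def inner_add_left)

lemma convex_cone_Int: "convex_cone A \<Longrightarrow> convex_cone B \<Longrightarrow> convex_cone (A \<inter> B)"
  by (simp add: convex_cone_iff)

lemma convex_cone_set_plus:
  assumes "convex_cone A" "convex_cone B"
  shows "convex_cone (A + B)"
proof -
  have "A + B = (\<Union>x\<in>A. \<Union>y\<in>B. {x + y})"
    by (auto simp: set_plus_def)
  then show ?thesis
    using convex_cone_sums[OF assms] by simp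
qed

section \<open>Slices of pointed cones\<close>

lemma convex_cone_ray: "convex_cone (ray e)"
proof -
  have "ray e = (\<lambda>c. c *\<^sub>R e) ` {0..}"
    by (auto simp: ray_def)
  moreover have "convex_cone {0::real..}"
    by (auto simp: convex_cone_iff)
  moreover have "linear (\<lambda>c. c *\<^sub>R e)"
    by (simp add: linear_iff scaleR_add_left)
  ultimately show ?thesis
    by (simp add: convex_cone_linear_image)
qed

lemma self_in_ray: "e \<in> ray e"
  unfolding ray_def by (auto intro: exI[of _ 1])

lemma ray_scaleR:
  assumes "0 < c"
  shows "ray (c *\<^sub>R e) = ray e"
proof
  have sub: "ray (r *\<^sub>R x) \<subseteq> ray x" if "0 < r" for r and x :: 'a
  proof -
    have "t *\<^sub>R r *\<^sub>R x \<in> ray x" if "0 \<le> t" for t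
      using that \<open>0 < r\<close> unfolding ray_def by (auto intro: exI[of _ "t * r"])
    then show ?thesis
      by (auto simp: ray_def)
  qed
  show "ray (c *\<^sub>R e) \<subseteq> ray e"
    by (rule sub[OF assms])
  show "ray e \<subseteq> ray (c *\<^sub>R e)"
    using sub[of "1 / c" "c *\<^sub>R e"] assms by simp
qed

text \<open>
  On the unit sphere of \<open>C\<close> the functional \<open>a\<close> has a positive minimum \<open>m\<close>, so points of
  height 1 have norm at most \<open>1 / m\<close>.
\<close>

lemma compact_cone_slice:
  fixes C :: "'a::euclidean_space set"
  assumes C: "convex_cone C" "closed C"
    and pos: "\<And>x. x \<in> C \<Longrightarrow> x \<noteq> 0 \<Longrightarrow> 0 < x \<bullet> a"
  shows "compact {x \<in> C. x \<bullet> a = 1}"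
proof -
  let ?U = "sphere 0 1 \<inter> C"
  have "compact ?U"
    using C by (simp add: compact_Int_closed)
  obtain m where m: "0 < m" "\<And>u. u \<in> ?U \<Longrightarrow> m \<le> u \<bullet> a"
  proof (cases "?U = {}")
    case True
    then show ?thesis using that[of 1] by auto
  next
    case False
    have "continuous_on ?U (\<lambda>u. u \<bullet> a)"
      by (intro continuous_intros)
    then obtain u where "u \<in> ?U" "\<And>v. v \<in> ?U \<Longrightarrow> u \<bullet> a \<le> v \<bullet> a"
      using continuous_attains_inf[OF \<open>compact ?U\<close> False] by blast
    moreover have "0 < u \<bullet> a"
      using pos[of u] \<open>u \<in> ?U\<close> by force
    ultimately show ?thesis using that by blast
  qed
  have "norm x \<le> 1 / m" if x: "x \<in> C" "x \<bullet> a = 1" for x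
  proof -
    have "x \<noteq> 0" using x by auto
    then have "(1 / norm x) *\<^sub>R x \<in> ?U"
      using convex_cone_scaleR[OF C(1) _ x(1), of "1 / norm x"] by simp
    from m(2)[OF this] have "m \<le> 1 / norm x"
      using x by simp
    then show ?thesis
      using m(1) \<open>x \<noteq> 0\<close> by (simp add: field_simps)
  qed
  then have "bounded {x \<in> C. x \<bullet> a = 1}"
    unfolding bounded_iff by blast
  moreover have "{x \<in> C. x \<bullet> a = 1} = C \<inter> {x. a \<bullet> x = 1}"
    by (auto simp: inner_commute)
  then have "closed {x \<in> C. x \<bullet> a = 1}"
    using C by (simp add: closed_Int closed_hyperplane)
  ultimately show ?thesis
    by (simp add: compact_eq_bounded_closed)
qed

lemma convex_cone_slice:
  assumes "convex_cone C"
  shows "convex {x \<in> C. x \<bullet> a = 1}"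
proof -
  have "{x \<in> C. x \<bullet> a = 1} = C \<inter> {x. a \<bullet> x = 1}"
    by (auto simp: inner_commute)
  then show ?thesis
    using assms by (simp add: convex_cone_def convex_Int convex_hyperplane)
qed

text \<open>
  If \<open>p + q\<close> lies on the ray and both summands have positive height, rescaling them to height 1
  exhibits \<open>e\<close> as a proper convex combination of two points of the slice, which must then
  both be \<open>e\<close>.
\<close>

lemma cone_face_ray_of_extreme_point:
  assumes C: "convex_cone C"
    and pos: "\<And>x. x \<in> C \<Longrightarrow> x \<noteq> 0 \<Longrightarrow> 0 < x \<bullet> a"
    and e: "e extreme_point_of {x \<in> C. x \<bullet> a = 1}"
  shows "cone_face (ray e) C"
proof -
  have eC: "e \<in> C" "e \<bullet> a = 1"
    and ext: "\<And>u v. u \<in> C \<Longrightarrow> u \<bullet> a = 1 \<Longrightarrow> v \<in> C \<Longrightarrow> v \<bullet> a = 1 \<Longrightarrow> e \<notin> open_segment u v"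
    using e by (auto simp: extreme_point_of_def)
  have "p \<in> ray e \<and> q \<in> ray e" if p: "p \<in> C" and q: "q \<in> C" and pq: "p + q \<in> ray e" for p q
  proof (cases "p = 0 \<or> q = 0")
    case True
    then show ?thesis
      using pq convex_cone_contains_0[OF convex_cone_ray[of e]] by auto
  next
    case False
    define s t where "s = p \<bullet> a" and "t = q \<bullet> a"
    have st: "0 < s" "0 < t"
      using False pos p q by (auto simp: s_def t_def)
    obtain c where c: "p + q = c *\<^sub>R e"
      using pq by (auto simp: ray_def)
    have cst: "c = s + t"
      using arg_cong[OF c, of "\<lambda>x. x \<bullet> a"] eC by (simp add: s_def t_def inner_add_left)
    define u v where "u = (1 / s) *\<^sub>R p" and "v = (1 / t) *\<^sub>R q"
    have uv: "u \<in> C" "v \<in> C" "u \<bullet> a = 1" "v \<bullet> a = 1"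
      using st convex_cone_scaleR[OF C _ p, of "1 / s"] convex_cone_scaleR[OF C _ q, of "1 / t"]
      by (auto simp: u_def v_def s_def t_def)
    have p_eq: "p = s *\<^sub>R u" and q_eq: "q = t *\<^sub>R v"
      using st by (simp_all add: u_def v_def)
    define r where "r = t / (s + t)"
    have r: "0 < r" "r < 1" "1 - r = s / (s + t)"
      using st by (auto simp: r_def field_simps)
    have "e = (1 / (s + t)) *\<^sub>R (s *\<^sub>R u + t *\<^sub>R v)"
      using c cst st unfolding p_eq q_eq by simp
    also have "\<dots> = (1 - r) *\<^sub>R u + r *\<^sub>R v"
      unfolding r(3) by (simp add: r_def scaleR_add_right)
    finally have comb: "e = (1 - r) *\<^sub>R u + r *\<^sub>R v" .
    have "u = v"
      using ext[OF uv(1,3,2,4)] comb r(1,2) unfolding in_segment by blast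
    then have "u = e" "v = e"
      using comb by (simp_all add: scaleR_left_diff_distrib)
    then show ?thesis
      using p_eq q_eq st by (auto simp: ray_def)
  qed
  moreover have "ray e \<subseteq> C"
    using convex_cone_scaleR[OF C _ eC(1)] by (auto simp: ray_def)
  ultimately show ?thesis
    by (auto simp: cone_face_def convex_cone_ray)
qed

section \<open>Properly minimal faces of a dual cone\<close>

text \<open>
  Any relative interior point \<open>a\<close> works: the segment from a point \<open>f\<close> of \<open>F\<close> to \<open>a\<close> can be prolonged
  inside \<open>F\<close>, so a functional that is nonnegative on \<open>F\<close> and zero at \<open>a\<close> cannot be
  positive at \<open>f\<close>. Being zero on all of \<open>F\<close>, it is orthogonal to \<open>span F\<close>.
\<close>

lemma ex_positive_on_dual_cone_Int_span:
  fixes F :: "'a::euclidean_space set"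
  assumes "convex_cone F"
  shows "\<exists>a. \<forall>x \<in> dual_cone F \<inter> span F. x \<noteq> 0 \<longrightarrow> 0 < x \<bullet> a"
proof -
  have F: "convex F" "F \<noteq> {}"
    using assms by (auto simp: convex_cone_def)
  obtain a where a: "a \<in> rel_interior F"
    using rel_interior_eq_empty[OF F(1)] F(2) by blast
  then have aF: "a \<in> F"
    using rel_interior_subset by blast
  have "0 < x \<bullet> a" if x: "x \<in> dual_cone F" "x \<in> span F" "x \<noteq> 0" for x
  proof (rule ccontr)
    assume "\<not> 0 < x \<bullet> a"
    then have xa: "x \<bullet> a = 0"
      using x(1) aF by (force simp: dual_cone_def)
    have "x \<bullet> f = 0" if f: "f \<in> F" for f
    proof -
      obtain t where t: "1 < t" "(1 - t) *\<^sub>R f + t *\<^sub>R a \<in> F"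
        using a f convex_rel_interior_iff[OF F] by blast
      have "0 \<le> x \<bullet> ((1 - t) *\<^sub>R f + t *\<^sub>R a)"
        using x(1) t(2) unfolding dual_cone_def by blast
      then have "0 \<le> (1 - t) * (x \<bullet> f)"
        using xa by (simp add: inner_add_right)
      moreover have "0 \<le> x \<bullet> f"
        using x(1) f unfolding dual_cone_def by blast
      ultimately show ?thesis
        using t(1) by (auto simp: zero_le_mult_iff)
    qed
    then have "x \<in> (span F)\<^sup>\<bottom>"
      by (simp add: in_orthogonal_comp_span_iff)
    with x show False
      using Int_orthogonal_comp_eq_0 by blast
  qed
  then show ?thesis
    by blast
qed

lemma lspace_dual_cone_subset_face:
  assumes "cone_face H (dual_cone F)"
  shows "(span F)\<^sup>\<bottom> \<subseteq> H"
proof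
  fix l assume l: "l \<in> (span F)\<^sup>\<bottom>"
  then have "l \<in> dual_cone F" "- l \<in> dual_cone F"
    by (simp_all add: in_orthogonal_comp_span_iff dual_cone_def)
  moreover have "l + - l \<in> H"
    using assms convex_cone_contains_0 by (auto simp: cone_face_def)
  ultimately show "l \<in> H"
    using assms unfolding cone_face_def by blast
qed

text \<open>
  The dual cone is the orthogonal sum of \<open>dual_cone F \<inter> span F\<close> and \<open>(span F)\<^sup>\<bottom>\<close>, so the face condition
  can be checked on the components in \<open>span F\<close>.
\<close>

lemma cone_face_plus_orthogonal_comp:
  fixes F :: "'a::euclidean_space set"
  assumes E: "cone_face E (dual_cone F \<inter> span F)"
  shows "cone_face (E + (span F)\<^sup>\<bottom>) (dual_cone F)"
proof -
  let ?L = "(span F)\<^sup>\<bottom>"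
  have Ecc: "convex_cone E" and ED: "E \<subseteq> dual_cone F" "E \<subseteq> span F"
    and face: "\<And>x y. \<lbrakk>x \<in> dual_cone F; x \<in> span F; y \<in> dual_cone F; y \<in> span F; x + y \<in> E\<rbrakk>
      \<Longrightarrow> x \<in> E \<and> y \<in> E"
    using E by (auto simp: cone_face_def)
  have sub: "subspace ?L"
    by (rule subspace_orthogonal_comp)
  have "x \<in> E + ?L \<and> y \<in> E + ?L"
    if x: "x \<in> dual_cone F" and y: "y \<in> dual_cone F" and xy: "x + y \<in> E + ?L" for x y
  proof -
    obtain p k where p: "p \<in> span F" "k \<in> ?L" "x = p + k"
      using subspace_orthogonal_decomp[OF subspace_span, of F x] by blast
    obtain q l where q: "q \<in> span F" "l \<in> ?L" "y = q + l"
      using subspace_orthogonal_decomp[OF subspace_span, of F y] by blast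
    obtain h m where h: "h \<in> E" "m \<in> ?L" "x + y = h + m"
      using xy by (auto simp: set_plus_def)
    have "p + q - h = m - k - l"
      using p q h by (simp add: algebra_simps)
    moreover have "p + q - h \<in> span F"
      using p q h ED by (auto intro: span_add span_diff)
    moreover have "m - k - l \<in> ?L"
      using p q h sub by (auto intro: subspace_diff)
    ultimately have "p + q = h"
      using Int_orthogonal_comp_eq_0[of "p + q - h" "span F"] by simp
    moreover have "p \<in> dual_cone F" "q \<in> dual_cone F"
      using dual_cone_add_orthogonal_comp[OF x, of "- k"] dual_cone_add_orthogonal_comp[OF y, of "- l"]
        p q sub by (auto intro: subspace_neg)
    ultimately have "p \<in> E" "q \<in> E"
      using face[of p q] p q h by auto
    then show ?thesis
      using p q by (auto intro: set_plus_intro)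
  qed
  moreover have "E + ?L \<subseteq> dual_cone F"
    using ED dual_cone_add_orthogonal_comp by (fastforce simp: set_plus_def)
  moreover have "convex_cone (E + ?L)"
    by (rule convex_cone_set_plus[OF Ecc subspace_imp_convex_cone[OF sub]])
  ultimately show ?thesis
    unfolding cone_face_def by blast
qed

text \<open>
  Minimality holds because a face strictly above \<open>(span F)\<^sup>\<bottom>\<close> and inside \<open>ray e + (span F)\<^sup>\<bottom>\<close> contains
  a positive multiple of \<open>e\<close>. The face \<open>H\<close> is allowed to be smaller than the whole dual cone so
  that properly minimal faces can be produced inside a prescribed one.
\<close>

lemma properly_minimal_face_ray_plus:
  fixes F :: "'a::euclidean_space set"
  assumes pos: "\<And>x. x \<in> dual_cone F \<inter> span F \<Longrightarrow> x \<noteq> 0 \<Longrightarrow> 0 < x \<bullet> a"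
    and H: "cone_face H (dual_cone F)"
    and e: "e extreme_point_of {x \<in> H \<inter> span F. x \<bullet> a = 1}"
  shows "properly_minimal_face (ray e + (span F)\<^sup>\<bottom>) (dual_cone F)"
proof -
  let ?L = "(span F)\<^sup>\<bottom>" and ?D = "dual_cone F"
  have HD: "H \<subseteq> ?D" and Hcc: "convex_cone H"
    using H by (auto simp: cone_face_def)
  have cc: "convex_cone (H \<inter> span F)"
    by (rule convex_cone_Int[OF Hcc convex_cone_span])
  have "cone_face (ray e) (H \<inter> span F)"
    using cone_face_ray_of_extreme_point[OF cc _ e] pos HD by blast
  then have "cone_face (ray e) (?D \<inter> span F)"
    using H unfolding cone_face_def by blast
  then have face: "cone_face (ray e + ?L) ?D"
    by (rule cone_face_plus_orthogonal_comp)
  have eS: "e \<in> span F" "e \<noteq> 0"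
    using e by (auto simp: extreme_point_of_def)
  have "e \<in> ray e + ?L"
    using set_plus_intro[OF self_in_ray subspace_0[OF subspace_orthogonal_comp]] by simp
  moreover have "e \<notin> ?L"
    using eS Int_orthogonal_comp_eq_0 by blast
  ultimately have ne: "ray e + ?L \<noteq> lspace ?D"
    unfolding lspace_dual_cone by blast
  have "ray e + ?L \<subseteq> E" if E: "cone_face E ?D" "?L \<subset> E" "E \<subset> ray e + ?L" for E
  proof -
    have Ecc: "convex_cone E"
      using E by (simp add: cone_face_def)
    obtain h where h: "h \<in> E" "h \<notin> ?L"
      using E(2) by blast
    then obtain c l where cl: "0 \<le> c" "l \<in> ?L" "h = c *\<^sub>R e + l"
      using E(3) by (force simp: set_plus_def ray_def)
    have "0 < c"
      using cl h by (cases "c = 0") auto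
    have "h + - l \<in> E"
      using convex_cone_add[OF Ecc h(1)] E(2) cl(2) subspace_neg[OF subspace_orthogonal_comp] by blast
    from convex_cone_scaleR[OF Ecc _ this, of "1 / c"] have "e \<in> E"
      using cl \<open>0 < c\<close> by simp
    then have "ray e \<subseteq> E"
      using Ecc by (auto simp: ray_def intro: convex_cone_scaleR)
    then show ?thesis
      using E(2) convex_cone_add[OF Ecc] by (auto simp: set_plus_def)
  qed
  then show ?thesis
    using face ne unfolding properly_minimal_face_def lspace_dual_cone by blast
qed

text \<open>
  The slice of \<open>H \<inter> span F\<close> is nonempty because \<open>H\<close> exceeds the lineality space. An
  extreme point of it yields a properly minimal face inside \<open>H\<close>, which by minimality of \<open>H\<close> is all
  of \<open>H\<close>.
\<close>

lemma properly_minimal_face_dual_coneE: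
  fixes F :: "'a::euclidean_space set"
  assumes F: "convex_cone F" and H: "properly_minimal_face H (dual_cone F)"
  obtains e where "e \<in> span F" "e \<noteq> 0" "H = ray e + (span F)\<^sup>\<bottom>"
proof -
  let ?L = "(span F)\<^sup>\<bottom>" and ?D = "dual_cone F"
  have Hf: "cone_face H ?D" and HL: "H \<noteq> ?L"
    and min: "\<And>E. cone_face E ?D \<Longrightarrow> ?L \<subset> E \<Longrightarrow> \<not> E \<subset> H"
    using H unfolding properly_minimal_face_def lspace_dual_cone by auto
  have Hcc: "convex_cone H" and HD: "H \<subseteq> ?D"
    using Hf by (auto simp: cone_face_def)
  have LH: "?L \<subseteq> H"
    by (rule lspace_dual_cone_subset_face[OF Hf])
  obtain a where "\<forall>x \<in> ?D \<inter> span F. x \<noteq> 0 \<longrightarrow> 0 < x \<bullet> a"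
    using ex_positive_on_dual_cone_Int_span[OF F] ..
  then have pos: "0 < x \<bullet> a" if "x \<in> ?D \<inter> span F" "x \<noteq> 0" for x
    using that by blast
  have "H face_of ?D"
    using Hf cone_face_iff_face_of[OF convex_cone_dual_cone] by blast
  moreover have "convex ?D"
    using convex_cone_dual_cone[of F] by (simp add: convex_cone_def)
  ultimately have "closed H"
    using face_of_imp_closed closed_dual_cone by blast
  let ?G = "H \<inter> span F"
  have G: "convex_cone ?G" "closed ?G"
    using convex_cone_Int[OF Hcc convex_cone_span] \<open>closed H\<close>
    by (simp_all add: closed_Int closed_subspace)
  let ?B = "{x \<in> ?G. x \<bullet> a = 1}"
  have comp: "compact ?B" and conv: "convex ?B"
    using compact_cone_slice[OF G] convex_cone_slice[OF G(1)] pos HD by blast+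
  have "?B \<noteq> {}"
  proof -
    obtain h where h: "h \<in> H" "h \<notin> ?L"
      using LH HL by blast
    obtain p l where p: "p \<in> span F" "l \<in> ?L" "h = p + l"
      using subspace_orthogonal_decomp[OF subspace_span, of F h] by blast
    have "h + - l \<in> H"
      using convex_cone_add[OF Hcc h(1)] LH p(2) subspace_neg[OF subspace_orthogonal_comp] by blast
    then have pG: "p \<in> ?G"
      using p by simp
    have "p \<noteq> 0"
      using p h by auto
    then have "0 < p \<bullet> a"
      using pos pG HD by blast
    then have "(1 / (p \<bullet> a)) *\<^sub>R p \<in> ?B"
      using convex_cone_scaleR[OF G(1) _ pG, of "1 / (p \<bullet> a)"] by simp
    then show ?thesis by blast
  qed
  then obtain e where e: "e extreme_point_of ?B"
    using extreme_point_exists_convex[OF comp conv] by blast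
  let ?E = "ray e + ?L"
  have eG: "e \<in> ?G" "e \<noteq> 0"
    using e by (auto simp: extreme_point_of_def)
  have E: "properly_minimal_face ?E ?D"
    by (rule properly_minimal_face_ray_plus[OF pos Hf e])
  then have Ef: "cone_face ?E ?D" "?E \<noteq> ?L"
    unfolding properly_minimal_face_def lspace_dual_cone by auto
  then have "?L \<subset> ?E"
    using lspace_dual_cone_subset_face by blast
  moreover have "ray e \<subseteq> H"
    using eG Hcc by (auto simp: ray_def intro: convex_cone_scaleR)
  then have "?E \<subseteq> H"
    using LH convex_cone_add[OF Hcc] by (auto simp: set_plus_def)
  ultimately have "H = ?E"
    using min Ef(1) by blast
  with eG show ?thesis
    using that by blast
qed

lemma ray_plus_orthogonal_comp_Int_span:
  assumes "e \<in> span F"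
  shows "(ray e + (span F)\<^sup>\<bottom>) \<inter> span F = ray e"
proof
  have ray: "ray e \<subseteq> span F"
    using assms by (auto simp: ray_def intro: span_scale)
  show "(ray e + (span F)\<^sup>\<bottom>) \<inter> span F \<subseteq> ray e"
  proof
    fix x assume x: "x \<in> (ray e + (span F)\<^sup>\<bottom>) \<inter> span F"
    then obtain r l where rl: "r \<in> ray e" "l \<in> (span F)\<^sup>\<bottom>" "x = r + l"
      by (auto simp: set_plus_def)
    have "x - r \<in> span F"
      using x ray rl(1) by (blast intro: span_diff)
    then have "l = 0"
      using rl Int_orthogonal_comp_eq_0[of l] by simp
    then show "x \<in> ray e"
      using rl by simp
  qed
  have "r \<in> ray e + (span F)\<^sup>\<bottom>" if "r \<in> ray e" for r
    using set_plus_intro[OF that subspace_0[OF subspace_orthogonal_comp]] by simp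
  then show "ray e \<subseteq> (ray e + (span F)\<^sup>\<bottom>) \<inter> span F"
    using ray by blast
qed

lemma face_unit_vector_ray_plus:
  assumes e: "e \<in> span F" "e \<noteq> 0"
  shows "face_unit_vector F (ray e + (span F)\<^sup>\<bottom>) = e /\<^sub>R norm e"
  unfolding face_unit_vector_def ray_plus_orthogonal_comp_Int_span[OF e(1)]
proof (rule the_equality)
  show "norm (e /\<^sub>R norm e) = 1 \<and> ray (e /\<^sub>R norm e) = ray e"
    using e(2) by (simp add: ray_scaleR)
next
  fix x assume x: "norm x = 1 \<and> ray x = ray e"
  have "x \<in> ray e"
    using self_in_ray[of x] x by simp
  then obtain c where c: "0 \<le> c" "x = c *\<^sub>R e"
    by (auto simp: ray_def)
  then have "c * norm e = 1"
    using x by simp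
  then have "c = inverse (norm e)"
    using inverse_unique[of "norm e" c] by (simp add: mult.commute)
  then show "x = e /\<^sub>R norm e"
    using c(2) by simp
qed

text \<open>
  Every nonzero point of \<open>dual_cone F \<inter> span F\<close> is a positive multiple of a point of the slice at
  height 1, to which the Krein-Milman theorem applies.
\<close>

lemma dual_cone_Int_span_subsetI:
  fixes F T :: "'a::euclidean_space set"
  assumes F: "convex_cone F" and T: "convex_cone T"
    and unit: "\<And>H. properly_minimal_face H (dual_cone F) \<Longrightarrow> face_unit_vector F H \<in> T"
  shows "dual_cone F \<inter> span F \<subseteq> T"
proof
  let ?D = "dual_cone F"
  fix x assume x: "x \<in> ?D \<inter> span F"
  obtain a where "\<forall>x \<in> ?D \<inter> span F. x \<noteq> 0 \<longrightarrow> 0 < x \<bullet> a"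
    using ex_positive_on_dual_cone_Int_span[OF F] ..
  then have pos: "0 < x \<bullet> a" if "x \<in> ?D \<inter> span F" "x \<noteq> 0" for x
    using that by blast
  have C: "convex_cone (?D \<inter> span F)" "closed (?D \<inter> span F)"
    by (rule convex_cone_Int[OF convex_cone_dual_cone convex_cone_span])
      (simp add: closed_Int closed_subspace closed_dual_cone)
  let ?B = "{x \<in> ?D \<inter> span F. x \<bullet> a = 1}"
  have D: "cone_face ?D ?D"
    using convex_cone_dual_cone[of F] by (simp add: cone_face_def)
  have "e \<in> T" if e: "e extreme_point_of ?B" for e
  proof -
    have eS: "e \<in> span F" "e \<noteq> 0"
      using e by (auto simp: extreme_point_of_def)
    have "e /\<^sub>R norm e \<in> T"
      using unit[OF properly_minimal_face_ray_plus[OF pos D e]] face_unit_vector_ray_plus[OF eS] by simp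
    from convex_cone_scaleR[OF T _ this, of "norm e"] show ?thesis
      using eS by simp
  qed
  then have "convex hull {e. e extreme_point_of ?B} \<subseteq> T"
    using T by (intro hull_minimal) (auto simp: convex_cone_def)
  then have BT: "?B \<subseteq> T"
    using Krein_Milman_Minkowski[OF compact_cone_slice[OF C pos] convex_cone_slice[OF C(1)]] by blast
  show "x \<in> T"
  proof (cases "x = 0")
    case True
    then show ?thesis using convex_cone_contains_0[OF T] by simp
  next
    case False
    then have xa: "0 < x \<bullet> a"
      using pos x by blast
    then have "(1 / (x \<bullet> a)) *\<^sub>R x \<in> ?B"
      using convex_cone_scaleR[OF C(1) _ x, of "1 / (x \<bullet> a)"] by simp
    then have "(1 / (x \<bullet> a)) *\<^sub>R x \<in> T"
      using BT by blast
    from convex_cone_scaleR[OF T _ this, of "x \<bullet> a"] show ?thesis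
      using xa by simp
  qed
qed

section \<open>Niceness at a face\<close>

lemma closed_convex_cone_separation:
  fixes C :: "'a::euclidean_space set"
  assumes C: "convex_cone C" "closed C" and y: "y \<notin> C"
  obtains z where "z \<in> dual_cone C" "z \<bullet> y < 0"
proof -
  have "convex C"
    using C(1) by (simp add: convex_cone_def)
  then obtain z b where z: "z \<bullet> y < b" "\<And>x. x \<in> C \<Longrightarrow> b < z \<bullet> x"
    using separating_hyperplane_closed_point[OF _ C(2) y] by blast
  have b: "b < 0"
    using z(2)[OF convex_cone_contains_0[OF C(1)]] by simp
  have "0 \<le> z \<bullet> x" if x: "x \<in> C" for x
  proof (rule ccontr)
    assume "\<not> 0 \<le> z \<bullet> x"
    then have neg: "z \<bullet> x < 0" by simp
    \<comment> \<open>Scaled by \<open>b / (z \<bullet> x)\<close>, the point reaches the separating hyperplane.\<close>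
    have "(b / (z \<bullet> x)) *\<^sub>R x \<in> C"
      by (rule convex_cone_scaleR[OF C(1) _ x]) (use b neg in \<open>simp add: divide_nonpos_neg\<close>)
    from z(2)[OF this] neg show False by simp
  qed
  then show ?thesis
    using that[of z] z(1) b by (simp add: dual_cone_def)
qed

lemma dual_cone_dual_cone_subset:
  fixes C :: "'a::euclidean_space set"
  assumes "convex_cone C" "closed C"
  shows "dual_cone (dual_cone C) \<subseteq> C"
proof
  fix y assume y: "y \<in> dual_cone (dual_cone C)"
  show "y \<in> C"
  proof (rule ccontr)
    assume "y \<notin> C"
    then obtain z where "z \<in> dual_cone C" "z \<bullet> y < 0"
      using closed_convex_cone_separation[OF assms] by blast
    with y show False
      by (force simp: dual_cone_def inner_commute)
  qed
qed

lemma cone_face_eq_Int_span: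
  fixes K :: "'a::euclidean_space set"
  assumes K: "convex_cone K" and F: "cone_face F K"
  shows "F = K \<inter> span F"
proof -
  have f: "F face_of K"
    using F cone_face_iff_face_of[OF K] by blast
  have "0 \<in> F"
    using F convex_cone_contains_0 by (auto simp: cone_face_def)
  then have "affine hull F = span F"
    by (simp add: affine_hull_span_0 hull_inc)
  then show ?thesis
    using face_of_imp_eq_affine_Int[OF _ f] K by (auto simp: convex_cone_def)
qed

lemma dual_cone_plus_subset:
  assumes "cone_face F K"
  shows "dual_cone K + (span F)\<^sup>\<bottom> \<subseteq> dual_cone F"
proof -
  have "dual_cone K \<subseteq> dual_cone F"
    using assms by (auto simp: cone_face_def dual_cone_def)
  then show ?thesis
    using dual_cone_add_orthogonal_comp by (auto simp: set_plus_def)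
qed

text \<open>
  A vector that separates a point from a closed \<open>dual_cone K + (span F)\<^sup>\<bottom>\<close> is nonnegative on both
  summands, hence lies in \<open>K\<close> by the bipolar theorem and is orthogonal to \<open>(span F)\<^sup>\<bottom>\<close>. So it lies in
  \<open>K \<inter> span F = F\<close>, and the point is not in \<open>dual_cone F\<close>.
\<close>

lemma closed_dual_cone_plus_iff:
  fixes K :: "'a::euclidean_space set"
  assumes K: "convex_cone K" "closed K" and F: "cone_face F K"
  shows "closed (dual_cone K + (span F)\<^sup>\<bottom>) \<longleftrightarrow> dual_cone F \<subseteq> dual_cone K + (span F)\<^sup>\<bottom>"
proof
  let ?L = "(span F)\<^sup>\<bottom>"
  let ?T = "dual_cone K + ?L"
  assume closed: "closed ?T"
  have sub: "subspace ?L"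
    by (rule subspace_orthogonal_comp)
  have T: "convex_cone ?T"
    by (rule convex_cone_set_plus[OF convex_cone_dual_cone subspace_imp_convex_cone[OF sub]])
  show "dual_cone F \<subseteq> ?T"
  proof (rule subsetI, rule ccontr)
    fix y assume y: "y \<in> dual_cone F" "y \<notin> ?T"
    obtain z where z: "z \<in> dual_cone ?T" "z \<bullet> y < 0"
      using closed_convex_cone_separation[OF T closed y(2)] .
    have "0 \<le> z \<bullet> k" if "k \<in> dual_cone K" for k
      using z(1) set_plus_intro[OF that subspace_0[OF sub]] by (auto simp: dual_cone_def)
    then have zK: "z \<in> K"
      using dual_cone_dual_cone_subset[OF K] by (auto simp: dual_cone_def)
    have "z \<bullet> l = 0" if l: "l \<in> ?L" for l
    proof -
      have "0 \<le> z \<bullet> m" if "m \<in> ?L" for m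
        using z(1) set_plus_intro[OF convex_cone_contains_0[OF convex_cone_dual_cone[of K]] that]
        by (auto simp: dual_cone_def)
      from this[OF l] this[OF subspace_neg[OF sub l]] show ?thesis by simp
    qed
    then have "z \<in> ?L\<^sup>\<bottom>"
      by (simp add: orthogonal_comp_def orthogonal_def inner_commute)
    then have "z \<in> span F"
      by (simp add: orthogonal_comp_self)
    then have "z \<in> F"
      using zK cone_face_eq_Int_span[OF K(1) F] by blast
    with y(1) z(2) show False
      by (force simp: dual_cone_def inner_commute)
  qed
next
  assume "dual_cone F \<subseteq> dual_cone K + (span F)\<^sup>\<bottom>"
  then have "dual_cone K + (span F)\<^sup>\<bottom> = dual_cone F"
    using dual_cone_plus_subset[OF F] by blast
  then show "closed (dual_cone K + (span F)\<^sup>\<bottom>)"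
    by (simp add: closed_dual_cone)
qed

lemma orth_proj_image_eq:
  fixes S :: "'a::euclidean_space set"
  assumes S: "subspace S"
  shows "orth_proj S ` A = (A + S\<^sup>\<bottom>) \<inter> S"
proof -
  note perp = subspace_orthogonal_comp[of S]
  have "orth_proj S x \<in> (A + S\<^sup>\<bottom>) \<inter> S" if "x \<in> A" for x
    using orth_proj[OF S, of x] set_plus_intro[OF that subspace_neg[OF perp], of "x - orth_proj S x"]
    by simp
  moreover have "x + l \<in> orth_proj S ` A" if x: "x \<in> A" "l \<in> S\<^sup>\<bottom>" "x + l \<in> S" for x l
  proof -
    have "x + l - orth_proj S x \<in> S"
      using orth_proj[OF S, of x] x by (simp add: subspace_diff[OF S])
    moreover have "(x - orth_proj S x) + l \<in> S\<^sup>\<bottom>"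
      using orth_proj[OF S, of x] x by (simp add: subspace_add[OF perp])
    then have "x + l - orth_proj S x \<in> S\<^sup>\<bottom>"
      by (simp add: algebra_simps)
    ultimately have "x + l = orth_proj S x"
      using Int_orthogonal_comp_eq_0[of "x + l - orth_proj S x" S] by simp
    then show ?thesis
      using x by simp
  qed
  ultimately show ?thesis
    by (auto simp: set_plus_def)
qed

lemma dual_cone_subset_plus_iff:
  fixes F :: "'a::euclidean_space set"
  assumes F: "convex_cone F"
  shows "dual_cone F \<subseteq> dual_cone K + (span F)\<^sup>\<bottom> \<longleftrightarrow>
    (\<forall>H. properly_minimal_face H (dual_cone F)
      \<longrightarrow> face_unit_vector F H \<in> orth_proj (span F) ` dual_cone K)"
    (is "_ \<subseteq> ?T \<longleftrightarrow> ?R")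
proof
  assume sub: "dual_cone F \<subseteq> ?T"
  show ?R
  proof (intro allI impI)
    fix H assume H: "properly_minimal_face H (dual_cone F)"
    obtain e where e: "e \<in> span F" "e \<noteq> 0" "H = ray e + (span F)\<^sup>\<bottom>"
      using properly_minimal_face_dual_coneE[OF F H] .
    let ?u = "face_unit_vector F H"
    have u: "?u = (1 / norm e) *\<^sub>R e"
      using face_unit_vector_ray_plus[OF e(1,2)] e(3) by (simp add: inverse_eq_divide)
    have "?u \<in> ray e"
      unfolding u ray_def by (auto intro: exI[of _ "1 / norm e"])
    then have "?u \<in> H \<inter> span F"
      using ray_plus_orthogonal_comp_Int_span[OF e(1)] e(3) by simp
    moreover have "H \<subseteq> dual_cone F"
      using H by (simp add: properly_minimal_face_def cone_face_def)
    ultimately have "?u \<in> ?T \<inter> span F"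
      using sub by (meson IntD1 IntD2 IntI subsetD)
    then show "?u \<in> orth_proj (span F) ` dual_cone K"
      by (simp add: orth_proj_image_eq)
  qed
next
  assume R: ?R
  have perp: "subspace ((span F)\<^sup>\<bottom>)"
    by (rule subspace_orthogonal_comp)
  have T: "convex_cone ?T"
    by (rule convex_cone_set_plus[OF convex_cone_dual_cone subspace_imp_convex_cone[OF perp]])
  have sub: "dual_cone F \<inter> span F \<subseteq> ?T"
    using R by (intro dual_cone_Int_span_subsetI[OF F T]) (simp add: orth_proj_image_eq)
  show "dual_cone F \<subseteq> ?T"
  proof
    fix x assume x: "x \<in> dual_cone F"
    obtain p l where p: "p \<in> span F" "l \<in> (span F)\<^sup>\<bottom>" "x = p + l"
      using subspace_orthogonal_decomp[OF subspace_span, of F x] by blast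
    have "p \<in> dual_cone F"
      using dual_cone_add_orthogonal_comp[OF x subspace_neg[OF perp p(2)]] p(3) by simp
    then have "p \<in> ?T"
      using p(1) sub by blast
    moreover have "l \<in> ?T"
      using set_plus_intro[OF convex_cone_contains_0[OF convex_cone_dual_cone[of K]] p(2)] by simp
    ultimately show "x \<in> ?T"
      using p(3) convex_cone_add[OF T] by simp
  qed
qed

theorem corollary2:
  fixes K :: "'a::euclidean_space set"
  assumes "convex_cone K" and "closed K"
  shows "nice K \<longleftrightarrow>
    (\<forall>F H. cone_face F K \<and> properly_minimal_face H (dual_cone F)
       \<longrightarrow> face_unit_vector F H \<in> orth_proj (span F) ` dual_cone K)"
proof -
  have "closed (dual_cone K + (span F)\<^sup>\<bottom>) \<longleftrightarrow>
      (\<forall>H. properly_minimal_face H (dual_cone F)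
        \<longrightarrow> face_unit_vector F H \<in> orth_proj (span F) ` dual_cone K)"
    if F: "cone_face F K" for F
  proof -
    have "convex_cone F"
      using F by (simp add: cone_face_def)
    then show ?thesis
      using closed_dual_cone_plus_iff[OF assms F] dual_cone_subset_plus_iff by simp
  qed
  then show ?thesis
    unfolding nice_def by blast
qed

end
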